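(* Let $r,s,l$ be nonnegative integers and let $m$ be a positive integer. Assume that all denominators occurring below are nonzero and that all series in the identity under consideration converge. If $m$ is odd, then $$\sum_{k=1}^\infty \frac{1}{w_{rk+l}\,w_{mk+s}\,w_{m(k+1)+s}} = \frac{1}{u_m w_{m+s}} \sum_{k=1}^\infty (-1)^{k-1} \frac{\bigl(w_{r(k+1)+l}+w_{rk+l}\bigr)u_{mk}}{w_{rk+l}\, w_{r(k+1)+l}\, w_{m(k+1)+s}}.$$ If $m$ is even, then $$\sum_{k=1}^\infty \frac{(-1)^k}{w_{rk+l}\,w_{mk+s}\,w_{m(k+1)+s}} = \frac{1}{u_m w_{m+s}} \sum_{k=1}^\infty (-1)^k \frac{\bigl(w_{r(k+1)+l}+w_{rk+l}\bigr)u_{mk}}{w_{rk+l}\, w_{r(k+1)+l}\, w_{m(k+1)+s}}.$$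
   Context: Let $a,b,p$ be complex numbers. The sequence $(w_n)_{n\ge 0}$ is defined by $w_0=a$, $w_1=b$, $w_n=p\,w_{n-1}+w_{n-2}$ for $n\ge 2$. The sequence $(u_n)_{n\ge0}$ is defined by $u_0=0$, $u_1=1$, $u_n=p\,u_{n-1}+u_{n-2}$ for $n\ge 2$. *)

theory Defs
  imports Complex_Main
begin

fun horadam_seq :: "complex \<Rightarrow> complex \<Rightarrow> complex \<Rightarrow> nat \<Rightarrow> complex" where
  "horadam_seq a b p 0 = a"
| "horadam_seq a b p (Suc 0) = b"
| "horadam_seq a b p (Suc (Suc n)) = p * horadam_seq a b p (Suc n) + horadam_seq a b p n"

end

theory Submission
  imports Defs
begin

text \<open>
  Put \<open>T k = u (m k) / (u m * w (m + s) * w (m k + m + s))\<close> and \<open>g k = 1 / w (r (k + 1) + l)\<close>.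
  A d'Ocagne-type identity (\<open>horadam_docagne\<close>) says that the consecutive differences of \<open>T\<close> are
  \<open>T (k + 1) - T k = (-1)^(m k) / (w (m (k + 1) + s) * w (m (k + 2) + s))\<close>.
  Hence, up to a global sign, the left-hand series is the alternating series
  \<open>\<Sum>k. (-1)^k * ((T (k + 1) - T k) * g k)\<close> for either parity of \<open>m\<close>, and the right-hand side is
  \<open>\<Sum>k. (-1)^k * (T (k + 1) * (g k + g (k + 1)))\<close>. Summation by parts (\<open>alternating_sum_by_parts\<close>)
  transforms the partial sums of one into those of the other, at the cost of the boundary term
  \<open>(-1)^N * (T N * g N)\<close>.

  The remaining point is that convergence of the two series forces \<open>T N * g N\<close> to vanish in the
  limit. If \<open>r = 0\<close>, then \<open>g\<close> is a nonzero constant and the terms of the right-hand series are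
  \<open>\<plusminus>2 g T (k + 1)\<close>, so \<open>T\<close> tends to zero. If \<open>r > 0\<close>, the terms of the left-hand series tend to zero,
  so \<open>w\<close> is unbounded. Binet's formula then shows that \<open>w\<close> grows, in modulus, at the largest rate
  possible for solutions of the recurrence (\<open>horadam_bounded_or_dominant\<close>): \<open>w\<close> tends to infinity
  while \<open>u n\<close> is of order at most \<open>w (n + i)\<close>. Therefore \<open>T\<close> is bounded and \<open>g\<close> tends to zero.
\<close>

section \<open>The addition formula and its consequence\<close>

lemma horadam_add:
  "horadam_seq a b p (Suc (i + n)) =
     horadam_seq 0 1 p (Suc i) * horadam_seq a b p (Suc n) + horadam_seq 0 1 p i * horadam_seq a b p n"
proof (induction i rule: induct_nat_012)
  case (ge2 i)
  have "horadam_seq a b p (Suc (Suc (Suc i) + n)) =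
      p * horadam_seq a b p (Suc (Suc i + n)) + horadam_seq a b p (Suc (i + n))"
    by simp
  also have "\<dots> = (p * horadam_seq 0 1 p (Suc (Suc i)) + horadam_seq 0 1 p (Suc i)) * horadam_seq a b p (Suc n)
      + (p * horadam_seq 0 1 p (Suc i) + horadam_seq 0 1 p i) * horadam_seq a b p n"
    unfolding ge2 by (simp only: algebra_simps)
  finally show ?case by (simp only: horadam_seq.simps)
qed simp_all

text \<open>
  By the addition formula, the left-hand side changes only its sign when \<open>i\<close> grows by one: both
  positive and both negative products at \<open>i\<close> and \<open>i + 1\<close> add up to the entry of the sequence with index
  \<open>2 i + j + n + 1\<close>.
\<close>

lemma horadam_docagne:
  "horadam_seq 0 1 p (i + j) * horadam_seq a b p (i + n)
     - horadam_seq 0 1 p i * horadam_seq a b p (i + j + n)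
   = (-1) ^ i * (horadam_seq 0 1 p j * horadam_seq a b p n)"
proof (induction i)
  case 0
  show ?case by simp
next
  case (Suc i)
  show ?case
    using Suc.IH horadam_add[of a b p "i + j" "i + n"] horadam_add[of a b p i "i + j + n"]
    by (simp add: algebra_simps)
qed

section \<open>Growth\<close>

text \<open>
  These are the roots of \<open>x\<^sup>2 = p x + 1\<close>, ordered by modulus. As their product is \<open>-1\<close>, the mode
  \<open>\<beta>^n\<close> is always bounded, so only \<open>\<alpha>\<close> or a coincidence of the two roots can cause growth.
\<close>

lemma horadam_roots:
  fixes p :: complex
  obtains \<alpha> \<beta> where "\<alpha> + \<beta> = p" "\<alpha> * \<beta> = -1" "norm \<alpha> \<ge> 1" "norm \<beta> \<le> 1"
proof -
  define d where "d = csqrt (p\<^sup>2 + 4)"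
  define x y where "x = (p + d) / 2" and "y = (p - d) / 2"
  have "d\<^sup>2 = p\<^sup>2 + 4"
    by (simp add: d_def)
  then have xy: "x + y = p" "x * y = -1"
    by (simp_all add: x_def y_def field_simps power2_eq_square)
  then have n: "norm x * norm y = 1"
    by (metis norm_minus_cancel norm_mult norm_one)
  show ?thesis
  proof (cases "norm x \<ge> 1")
    case True
    then have "norm y \<le> 1"
      using n mult_right_mono[OF True norm_ge_zero[of y]] by simp
    then show ?thesis using that xy True by blast
  next
    case False
    then have "norm y \<ge> 1"
      using n mult_right_mono[of "norm x" 1 "norm y"] by simp
    then show ?thesis using that[of y x] xy False by (simp add: ac_simps)
  qed
qed

lemma horadam_binet_distinct:
  assumes "\<alpha> + \<beta> = p" "\<alpha> * \<beta> = -1" "\<alpha> \<noteq> \<beta>"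
  shows "horadam_seq a b p n =
    (b - a * \<beta>) / (\<alpha> - \<beta>) * \<alpha> ^ n + (a * \<alpha> - b) / (\<alpha> - \<beta>) * \<beta> ^ n"
proof -
  have sq: "\<alpha> * \<alpha> = p * \<alpha> + 1" "\<beta> * \<beta> = p * \<beta> + 1"
    using assms by (auto simp: algebra_simps)
  have "(\<alpha> - \<beta>) * horadam_seq a b p n = (b - a * \<beta>) * \<alpha> ^ n + (a * \<alpha> - b) * \<beta> ^ n"
  proof (induction n rule: induct_nat_012)
    case (ge2 n)
    have pow: "\<alpha> ^ Suc (Suc n) = p * \<alpha> ^ Suc n + \<alpha> ^ n" "\<beta> ^ Suc (Suc n) = p * \<beta> ^ Suc n + \<beta> ^ n"
      by (simp_all add: mult.assoc[symmetric] sq) (simp_all add: algebra_simps)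
    have "(\<alpha> - \<beta>) * horadam_seq a b p (Suc (Suc n)) =
        p * ((\<alpha> - \<beta>) * horadam_seq a b p (Suc n)) + (\<alpha> - \<beta>) * horadam_seq a b p n"
      by (simp add: algebra_simps)
    also have "\<dots> = (b - a * \<beta>) * (p * \<alpha> ^ Suc n + \<alpha> ^ n) + (a * \<alpha> - b) * (p * \<beta> ^ Suc n + \<beta> ^ n)"
      unfolding ge2 by (simp add: algebra_simps del: power_Suc)
    finally show ?case unfolding pow .
  qed (simp_all add: algebra_simps)
  then have "horadam_seq a b p n = ((b - a * \<beta>) * \<alpha> ^ n + (a * \<alpha> - b) * \<beta> ^ n) / (\<alpha> - \<beta>)"
    using assms(3) by (simp only: eq_divide_eq mult.commute[of _ "\<alpha> - \<beta>"]) simp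
  then show ?thesis by (simp add: add_divide_distrib)
qed

lemma horadam_binet_double:
  assumes "2 * \<alpha> = p" "\<alpha> * \<alpha> = -1"
  shows "horadam_seq a b p n = (a + of_nat n * (b / \<alpha> - a)) * \<alpha> ^ n"
proof -
  have nz: "\<alpha> \<noteq> 0" using assms by auto
  show ?thesis
  proof (induction n rule: induct_nat_012)
    case (ge2 n)
    have sq: "\<alpha> ^ Suc (Suc n) = - (\<alpha> ^ n)"
      using assms(2) by (simp add: mult.assoc[symmetric])
    have "p * \<alpha> ^ Suc n = 2 * (\<alpha> * \<alpha>) * \<alpha> ^ n"
      by (simp flip: assms(1))
    then have p\<alpha>: "p * \<alpha> ^ Suc n = - 2 * \<alpha> ^ n"
      unfolding assms(2) by simp
    have e: "p * (x * \<alpha> ^ Suc n) + y * \<alpha> ^ n = (2 * x - y) * \<alpha> ^ Suc (Suc n)" for x y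
      unfolding mult.left_commute[of p] p\<alpha> sq by (simp add: algebra_simps)
    show ?case
      unfolding horadam_seq.simps ge2 e by (simp add: algebra_simps)
  qed (use nz in \<open>simp_all add: field_simps\<close>)
qed

text \<open>
  An unbounded solution involves the growing mode of the recurrence, \<open>\<alpha>^n\<close> with \<open>|\<alpha>| > 1\<close> or
  \<open>n \<alpha>^n\<close> for a double root \<open>\<alpha>\<close> (then \<open>|\<alpha>| = 1\<close>), and \<open>\<rho>\<close> is the modulus of that mode. As \<open>\<rho>\<close> is
  monotone, the two estimates may be compared at shifted indices.
\<close>

lemma horadam_bounded_or_dominant:
  obtains (bounded) C where "\<And>n. norm (horadam_seq a b p n) \<le> C"
  | (dominant) \<rho> :: "nat \<Rightarrow> real" and c C where
      "c > 0" "C > 0" "mono \<rho>" "filterlim \<rho> at_top sequentially"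
      "\<forall>\<^sub>F n in sequentially. c * \<rho> n \<le> norm (horadam_seq a b p n)"
      "\<And>n. norm (horadam_seq 0 1 p n) \<le> C * \<rho> n"
proof -
  obtain \<alpha> \<beta> where roots: "\<alpha> + \<beta> = p" "\<alpha> * \<beta> = -1" and n\<alpha>: "norm \<alpha> \<ge> 1" and n\<beta>: "norm \<beta> \<le> 1"
    by (rule horadam_roots)
  have \<beta>1: "norm \<beta> ^ n \<le> 1" for n
    using n\<beta> by (simp add: power_le_one)
  (* A linear lower bound with an additive error is a proportional one once \<rho> is large. *)
  have lower: "\<forall>\<^sub>F n in sequentially. A / 2 * \<rho> n \<le> norm (horadam_seq a b p n)"
    if "A > 0" "filterlim \<rho> at_top sequentially" "\<And>n. A * \<rho> n - B \<le> norm (horadam_seq a b p n)"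
    for \<rho> :: "nat \<Rightarrow> real" and A B :: real
  proof -
    have "\<forall>\<^sub>F n in sequentially. \<rho> n \<ge> 2 * B / A"
      using that(2) by (simp add: filterlim_at_top)
    then show ?thesis
    proof eventually_elim
      case (elim n)
      then have "A / 2 * \<rho> n \<ge> B" using that(1) by (simp add: field_simps)
      then show ?case using that(3)[of n] by simp
    qed
  qed
  show ?thesis
  proof (cases "\<alpha> = \<beta>")
    case False
    define A B where "A = (b - a * \<beta>) / (\<alpha> - \<beta>)" and "B = (a * \<alpha> - b) / (\<alpha> - \<beta>)"
    have w: "horadam_seq a b p n = A * \<alpha> ^ n + B * \<beta> ^ n" for n
      unfolding A_def B_def by (rule horadam_binet_distinct[OF roots False])
    have nB: "norm (B * \<beta> ^ n) \<le> norm B" for n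
      using \<beta>1[of n] by (simp add: norm_mult norm_power mult_left_le)
    show ?thesis
    proof (cases "A = 0 \<or> norm \<alpha> = 1")
      case True
      then have "norm (A * \<alpha> ^ n) \<le> norm A" for n
        by (auto simp: norm_mult norm_power)
      then have "norm (horadam_seq a b p n) \<le> norm A + norm B" for n
        unfolding w using nB[of n] norm_triangle_mono by blast
      then show ?thesis by (rule bounded)
    next
      case False
      define D where "D = norm (\<alpha> - \<beta>)"
      have D: "D > 0" using \<open>\<alpha> \<noteq> \<beta>\<close> by (simp add: D_def)
      have lim: "filterlim (\<lambda>n. norm \<alpha> ^ n) at_top sequentially"
        using filterlim_at_infinity_imp_norm_at_top[OF filterlim_realpow_sequentially_gt1[of \<alpha>]]
          False n\<alpha> by (simp add: norm_power)
      have "norm A * norm \<alpha> ^ n - norm B \<le> norm (horadam_seq a b p n)" for n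
        unfolding w using norm_diff_ineq[of "A * \<alpha> ^ n" "B * \<beta> ^ n"] nB[of n]
        by (simp add: norm_mult norm_power)
      then have low: "\<forall>\<^sub>F n in sequentially.
          norm A / 2 * norm \<alpha> ^ n \<le> norm (horadam_seq a b p n)"
        using False lim by (intro lower) auto
      have up: "norm (horadam_seq 0 1 p n) \<le> 2 / D * norm \<alpha> ^ n" for n
      proof -
        have "horadam_seq 0 1 p n = (\<alpha> ^ n - \<beta> ^ n) / (\<alpha> - \<beta>)"
          using horadam_binet_distinct[OF roots \<open>\<alpha> \<noteq> \<beta>\<close>, of 0 1 n] by (simp add: diff_divide_distrib)
        moreover have "norm (\<alpha> ^ n - \<beta> ^ n) \<le> norm \<alpha> ^ n + 1"
          using norm_triangle_ineq4[of "\<alpha> ^ n" "\<beta> ^ n"] \<beta>1[of n] by (simp add: norm_power)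
        moreover have "norm \<alpha> ^ n \<ge> 1" using n\<alpha> by simp
        ultimately show ?thesis
          using D by (simp add: norm_divide D_def divide_right_mono)
      qed
      show ?thesis
        by (rule dominant[OF _ _ _ lim low up])
          (use D False n\<alpha> in \<open>auto intro!: monoI power_increasing\<close>)
    qed
  next
    case True
    then have dbl: "2 * \<alpha> = p" "\<alpha> * \<alpha> = -1" using roots by auto
    have "norm \<alpha> * norm \<alpha> = 1"
      using dbl(2) by (metis norm_minus_cancel norm_mult norm_one)
    then have n1: "norm \<alpha> = 1"
      using True n\<alpha> n\<beta> by simp
    define B where "B = b / \<alpha> - a"
    have w: "norm (horadam_seq a b p n) = norm (a + of_nat n * B)" for n
      using horadam_binet_double[OF dbl, of a b n] n1 by (simp add: B_def norm_mult norm_power)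
    show ?thesis
    proof (cases "B = 0")
      case True
      then show ?thesis using bounded[of "norm a"] w by simp
    next
      case False
      have "norm B * real n - norm a \<le> norm (horadam_seq a b p n)" for n
        unfolding w using norm_diff_ineq[of "of_nat n * B" a] by (simp add: norm_mult ac_simps)
      then have low: "\<forall>\<^sub>F n in sequentially. norm B / 2 * real n \<le> norm (horadam_seq a b p n)"
        using False filterlim_real_sequentially by (intro lower) auto
      have up: "norm (horadam_seq 0 1 p n) \<le> 1 * real n" for n
        using horadam_binet_double[OF dbl, of 0 1 n] n1 by (simp add: norm_mult norm_power norm_divide)
      show ?thesis
        by (rule dominant[OF _ _ _ filterlim_real_sequentially low up])
          (use False in \<open>auto intro!: monoI\<close>)
    qed
  qed
qed

text \<open>
  The form in which growth is used: \<open>w\<close> tending to infinity makes \<open>g\<close> vanish in the limit, and the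
  comparison of \<open>u\<close> with \<open>w\<close> bounds \<open>T\<close>.
\<close>

lemma horadam_unbounded:
  assumes "\<nexists>C. \<forall>n. norm (horadam_seq a b p n) \<le> C"
  shows "filterlim (horadam_seq a b p) at_infinity sequentially"
    and "\<exists>K. \<forall>\<^sub>F n in sequentially. norm (horadam_seq 0 1 p n) \<le> K * norm (horadam_seq a b p (n + i))"
proof -
  show "filterlim (horadam_seq a b p) at_infinity sequentially"
  proof (cases rule: horadam_bounded_or_dominant[of a b p])
    case (dominant \<rho> c C)
    have "filterlim (\<lambda>n. c * \<rho> n) at_top sequentially"
      by (rule filterlim_tendsto_pos_mult_at_top[OF tendsto_const dominant(1,4)])
    then have "filterlim (\<lambda>n. norm (horadam_seq a b p n)) at_top sequentially"
      using dominant(5) by (rule filterlim_at_top_mono)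
    then show ?thesis
      by (rule filterlim_norm_at_top_imp_at_infinity)
  qed (use assms in blast)
  show "\<exists>K. \<forall>\<^sub>F n in sequentially. norm (horadam_seq 0 1 p n) \<le> K * norm (horadam_seq a b p (n + i))"
  proof (cases rule: horadam_bounded_or_dominant[of a b p])
    case (dominant \<rho> c C)
    have "\<forall>\<^sub>F n in sequentially. c * \<rho> (n + i) \<le> norm (horadam_seq a b p (n + i))"
      using dominant(5) by (rule eventually_sequentially_seg[THEN iffD2])
    then have "\<forall>\<^sub>F n in sequentially.
        norm (horadam_seq 0 1 p n) \<le> C / c * norm (horadam_seq a b p (n + i))"
    proof eventually_elim
      case (elim n)
      have "norm (horadam_seq 0 1 p n) \<le> C * \<rho> n" by (rule dominant(6))
      also have "\<dots> \<le> C * \<rho> (n + i)"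
        using dominant(2,3) by (simp add: monoD)
      also have "\<dots> = C / c * (c * \<rho> (n + i))" using dominant(1) by simp
      also have "\<dots> \<le> C / c * norm (horadam_seq a b p (n + i))"
        using dominant(1,2) elim by (intro mult_left_mono) auto
      finally show ?case .
    qed
    then show ?thesis by blast
  qed (use assms in blast)
qed

section \<open>Summation by parts\<close>

lemma alternating_sum_by_parts:
  fixes T g :: "nat \<Rightarrow> 'a :: comm_ring_1"
  assumes "T 0 = 0"
  shows "(\<Sum>k<N. (-1) ^ k * ((T (Suc k) - T k) * g k)) =
    (\<Sum>k<N. (-1) ^ k * (T (Suc k) * (g k + g (Suc k)))) + (-1) ^ N * (T N * g N)"
  by (induction N) (simp_all add: assms algebra_simps)

lemma alternating_suminf_by_parts:
  fixes T g :: "nat \<Rightarrow> 'a :: {real_normed_algebra_1, comm_ring_1}"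
  assumes "T 0 = 0" and lim: "(\<lambda>N. T N * g N) \<longlonglongrightarrow> 0"
    and "summable (\<lambda>k. (-1) ^ k * (T (Suc k) * (g k + g (Suc k))))"
  shows "(\<Sum>k. (-1) ^ k * ((T (Suc k) - T k) * g k)) =
    (\<Sum>k. (-1) ^ k * (T (Suc k) * (g k + g (Suc k))))"
proof -
  have "(\<lambda>N. (-1) ^ N * (T N * g N)) \<longlonglongrightarrow> 0"
    using lim by (simp add: lim_sequentially dist_norm minus_one_power_iff)
  then have "(\<lambda>k. (-1) ^ k * ((T (Suc k) - T k) * g k)) sums
      ((\<Sum>k. (-1) ^ k * (T (Suc k) * (g k + g (Suc k)))) + 0)"
    unfolding sums_def alternating_sum_by_parts[of T, OF assms(1)]
    by (intro tendsto_add summable_LIMSEQ assms(3))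
  then show ?thesis by (simp add: sums_iff)
qed

theorem theorem1:
  fixes a b p :: complex
    and w u :: "nat \<Rightarrow> complex"
    and r s l m :: nat
  assumes w: "w = horadam_seq a b p"
    and u: "u = horadam_seq 0 1 p"
    and m_pos: "m > 0"
    and w_r_nz: "\<And>k. k \<ge> 1 \<Longrightarrow> w (r * k + l) \<noteq> 0"
    and w_m_nz: "\<And>k. k \<ge> 1 \<Longrightarrow> w (m * k + s) \<noteq> 0"
    and u_nz: "u m \<noteq> 0"
  shows
    "(odd m \<longrightarrow>
        summable (\<lambda>k. 1 / (w (r * (k + 1) + l) * w (m * (k + 1) + s) * w (m * (k + 2) + s))) \<longrightarrow>
        summable (\<lambda>k. (-1) ^ k * ((w (r * (k + 2) + l) + w (r * (k + 1) + l)) * u (m * (k + 1)) /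
          (w (r * (k + 1) + l) * w (r * (k + 2) + l) * w (m * (k + 2) + s)))) \<longrightarrow>
        (\<Sum>k. 1 / (w (r * (k + 1) + l) * w (m * (k + 1) + s) * w (m * (k + 2) + s))) =
        1 / (u m * w (m + s)) *
        (\<Sum>k. (-1) ^ k * ((w (r * (k + 2) + l) + w (r * (k + 1) + l)) * u (m * (k + 1)) /
          (w (r * (k + 1) + l) * w (r * (k + 2) + l) * w (m * (k + 2) + s))))) \<and>
     (even m \<longrightarrow>
        summable (\<lambda>k. (-1) ^ (k + 1) /
          (w (r * (k + 1) + l) * w (m * (k + 1) + s) * w (m * (k + 2) + s))) \<longrightarrow>
        summable (\<lambda>k. (-1) ^ (k + 1) *
          ((w (r * (k + 2) + l) + w (r * (k + 1) + l)) * u (m * (k + 1)) /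
          (w (r * (k + 1) + l) * w (r * (k + 2) + l) * w (m * (k + 2) + s)))) \<longrightarrow>
        (\<Sum>k. (-1) ^ (k + 1) /
          (w (r * (k + 1) + l) * w (m * (k + 1) + s) * w (m * (k + 2) + s))) =
        1 / (u m * w (m + s)) *
        (\<Sum>k. (-1) ^ (k + 1) *
          ((w (r * (k + 2) + l) + w (r * (k + 1) + l)) * u (m * (k + 1)) /
          (w (r * (k + 1) + l) * w (r * (k + 2) + l) * w (m * (k + 2) + s)))))"
proof -
  define Q where "Q = u m * w (m + s)"
  define T where "T k = u (m * k) / (Q * w (m * (k + 1) + s))" for k
  define g where "g k = 1 / w (r * (k + 1) + l)" for k
  have w1: "w (r * (k + 1) + l) \<noteq> 0" "w (m * (k + 1) + s) \<noteq> 0" for k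
    using w_r_nz[of "k + 1"] w_m_nz[of "k + 1"] by simp_all
  have w2: "w (r * (k + 2) + l) \<noteq> 0" "w (m * (k + 2) + s) \<noteq> 0" for k
    using w_r_nz[of "k + 2"] w_m_nz[of "k + 2"] by simp_all
  have Q: "Q \<noteq> 0" using w1(2)[of 0] u_nz by (simp add: Q_def)
  have T0: "T 0 = 0" by (simp add: T_def u)
  let ?L = "\<lambda>k. (-1) ^ k * ((T (Suc k) - T k) * g k)"
  let ?R = "\<lambda>k. (-1) ^ k * (T (Suc k) * (g k + g (Suc k)))"
  let ?P = "\<lambda>k. w (r * (k + 1) + l) * w (m * (k + 1) + s) * w (m * (k + 2) + s)"
  let ?E = "\<lambda>k. (w (r * (k + 2) + l) + w (r * (k + 1) + l)) * u (m * (k + 1)) /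
          (w (r * (k + 1) + l) * w (r * (k + 2) + l) * w (m * (k + 2) + s))"

  have diff: "T (Suc k) - T k = (-1) ^ (m * k) / (w (m * (k + 1) + s) * w (m * (k + 2) + s))" for k
  proof -
    have doc: "u (m * (k + 1)) * w (m * (k + 1) + s) - u (m * k) * w (m * (k + 2) + s) =
        (-1) ^ (m * k) * Q"
      using horadam_docagne[of p "m * k" m a b "m + s"] by (simp add: w u Q_def algebra_simps)
    have "T (Suc k) - T k =
        (u (m * (k + 1)) * w (m * (k + 1) + s) - u (m * k) * w (m * (k + 2) + s)) /
        (Q * (w (m * (k + 1) + s) * w (m * (k + 2) + s)))"
      using w1(2)[of k] w2(2)[of k] Q by (simp add: T_def field_simps)
    then show ?thesis unfolding doc using Q by simp
  qed
  have L: "?L k = (-1) ^ (m * k + k) / ?P k" for k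
    unfolding diff g_def by (simp add: power_add ac_simps)
  have R: "?R k = 1 / Q * ((-1) ^ k * ?E k)" for k
  proof -
    have "g k + g (Suc k) = (w (r * (k + 2) + l) + w (r * (k + 1) + l)) /
        (w (r * (k + 1) + l) * w (r * (k + 2) + l))"
      using w1(1)[of k] w2(1)[of k] by (simp add: g_def field_simps)
    then show ?thesis unfolding T_def by (simp add: mult_ac)
  qed

  have boundary: "(\<lambda>N. T N * g N) \<longlonglongrightarrow> 0" if sL: "summable ?L" and sR: "summable ?R"
  proof (cases "r = 0")
    case True
    have "(\<lambda>k. norm (?R k)) \<longlonglongrightarrow> 0"
      using summable_LIMSEQ_zero[OF sR] by (rule tendsto_norm_zero)
    moreover have "norm (?R k) = 2 * norm (T (Suc k) * g (Suc k))" for k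
    proof -
      have "g k = g (Suc k)" using True by (simp add: g_def)
      then show ?thesis by (simp add: norm_mult norm_power flip: mult_2)
    qed
    ultimately have "(\<lambda>k. norm (T (Suc k) * g (Suc k))) \<longlonglongrightarrow> 0"
      using tendsto_mult_left[of "\<lambda>k. 2 * norm (T (Suc k) * g (Suc k))" 0 _ "1 / 2"] by simp
    then have "(\<lambda>k. T (Suc k) * g (Suc k)) \<longlonglongrightarrow> 0"
      by (rule tendsto_norm_zero_cancel)
    then show ?thesis
      by (rule LIMSEQ_imp_Suc)
  next
    case False
    have unbounded: "\<nexists>C. \<forall>n. norm (horadam_seq a b p n) \<le> C"
    proof
      assume "\<exists>C. \<forall>n. norm (horadam_seq a b p n) \<le> C"
      then obtain C where C: "\<And>n. norm (w n) \<le> C" unfolding w by blast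
      have "norm (w (r * (0 + 1) + l)) > 0" using w1(1)[of 0] by simp
      then have C0: "C > 0" using C less_le_trans by blast
      (* Bounded w would keep the terms of the left-hand series away from zero. *)
      have low: "1 / C ^ 3 \<le> norm (?L k)" for k
      proof -
        have "norm (?P k) \<le> C ^ 3"
          unfolding norm_mult power3_eq_cube using C C0 by (intro mult_mono) auto
        moreover have "norm (?P k) > 0" using w1[of k] w2(2)[of k] by simp
        ultimately have "1 / C ^ 3 \<le> 1 / norm (?P k)" using C0 by (intro frac_le) auto
        then show ?thesis unfolding L by (simp add: norm_divide norm_power)
      qed
      have "(\<lambda>k. norm (?L k)) \<longlonglongrightarrow> 0"
        using summable_LIMSEQ_zero[OF sL] by (rule tendsto_norm_zero)
      then have "1 / C ^ 3 \<le> 0" by (rule LIMSEQ_le_const) (use low in blast)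
      then show False using C0 by simp
    qed
    obtain K where "\<forall>\<^sub>F n in sequentially. norm (u n) \<le> K * norm (w (n + (m + s)))"
      using horadam_unbounded(2)[OF unbounded] unfolding w u by blast
    moreover have subseq: "filterlim (\<lambda>k. d * k + e) sequentially sequentially" if "d > 0" for d e :: nat
      using that by (intro filterlim_subseq) (simp add: strict_mono_def)
    ultimately have "\<forall>\<^sub>F k in sequentially. norm (u (m * k + 0)) \<le> K * norm (w (m * k + 0 + (m + s)))"
      using m_pos eventually_compose_filterlim by blast
    then have "\<forall>\<^sub>F k in sequentially. norm (T k) \<le> K / norm Q"
    proof eventually_elim
      case (elim k)
      then have "norm (u (m * k)) \<le> K * norm (w (m * (k + 1) + s))"
        by (simp add: algebra_simps)
      then have "norm (u (m * k)) / norm (w (m * (k + 1) + s)) \<le> K"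
        using w1(2)[of k] by (simp add: divide_le_eq)
      then show ?case
        using Q by (simp add: T_def norm_divide norm_mult field_simps)
    qed
    then have "Bfun T sequentially" by (rule BfunI)
    moreover have "Zfun g sequentially"
    proof -
      have "filterlim (\<lambda>k. w (r * k + (r + l))) at_infinity sequentially"
        by (rule filterlim_compose[OF horadam_unbounded(1)[OF unbounded, folded w] subseq])
          (use False in simp)
      then have "(\<lambda>k. inverse (w (r * k + (r + l)))) \<longlonglongrightarrow> 0"
        by (rule filterlim_compose[OF tendsto_inverse_0])
      moreover have "g = (\<lambda>k. inverse (w (r * k + (r + l))))"
        by (simp add: fun_eq_iff g_def inverse_eq_divide algebra_simps)
      ultimately show ?thesis
        by (simp add: tendsto_Zfun_iff)
    qed
    ultimately show ?thesis
      using bounded_bilinear.Bfun_prod_Zfun[OF bounded_bilinear_mult] by (simp add: tendsto_Zfun_iff)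
  qed

  have main: "suminf ?L = 1 / Q * (\<Sum>k. (-1) ^ k * ?E k)"
    if sL: "summable ?L" and sE: "summable (\<lambda>k. (-1) ^ k * ?E k)"
  proof -
    have sR: "summable ?R" unfolding R by (rule summable_mult[OF sE])
    have "suminf ?L = suminf ?R"
      by (rule alternating_suminf_by_parts[OF T0 boundary[OF sL sR] sR])
    then show ?thesis unfolding R suminf_mult[OF sE] .
  qed

  show ?thesis
  proof (intro conjI impI)
    assume "odd m" and sL: "summable (\<lambda>k. 1 / ?P k)" and sE: "summable (\<lambda>k. (-1) ^ k * ?E k)"
    then have "?L = (\<lambda>k. 1 / ?P k)"
      unfolding L by (auto simp: fun_eq_iff)
    then show "(\<Sum>k. 1 / ?P k) = 1 / (u m * w (m + s)) * (\<Sum>k. (-1) ^ k * ?E k)"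
      using main sL sE unfolding Q_def by simp
  next
    assume "even m" and sL: "summable (\<lambda>k. (-1) ^ (k + 1) / ?P k)"
      and sE: "summable (\<lambda>k. (-1) ^ (k + 1) * ?E k)"
    then have eL: "(\<lambda>k. (-1) ^ (k + 1) / ?P k) = (\<lambda>k. - ?L k)"
      unfolding L by (auto simp: fun_eq_iff power_add power_mult)
    have eE: "(\<lambda>k. (-1) ^ (k + 1) * ?E k) = (\<lambda>k. - ((-1) ^ k * ?E k))"
      by (simp add: fun_eq_iff)
    have s: "summable ?L" "summable (\<lambda>k. (-1) ^ k * ?E k)"
      using sL sE unfolding eL eE summable_minus_iff .
    show "(\<Sum>k. (-1) ^ (k + 1) / ?P k) = 1 / (u m * w (m + s)) * (\<Sum>k. (-1) ^ (k + 1) * ?E k)"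
      unfolding eL eE suminf_minus[OF s(1)] suminf_minus[OF s(2)] main[OF s] Q_def by simp
  qed
qed

end
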